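(* Let $\mathcal{I}$ be a proper $<\mathfrak{c}$-ideal on $\mathbb{R}$ containing $[\mathbb{R}]^{<\mathfrak{c}}$ with $cf(\mathcal{I})=\mathfrak{c}$. Then there is a weak selection $f$ on $\mathbb{R}$ such that $\mathcal{N}_f=\mathcal{I}$.
   Context: $\mathfrak{c}$ is the cardinality of $\mathbb{R}$, and $[\mathbb{R}]^{<\mathfrak{c}}$ is the family of subsets of $\mathbb{R}$ of cardinality less than $\mathfrak{c}$. An ideal $\mathcal{I}$ on $\mathbb{R}$ is a $<\mathfrak{c}$-ideal if it is closed under unions of subfamilies of size $<\mathfrak{c}$; it is proper if $\mathbb{R}\notin\mathcal{I}$. The cofinality $cf(\mathcal{I})$ is the least cardinality of a subset $\mathcal{B}\subseteq\mathcal{I}$ such that for every $I\in\mathcal{I}$ there is $B\in\mathcal{B}$ with $I\subseteq B$. A weak selection on $\mathbb{R}$ is a function $f:[\mathbb{R}]^2\to\mathbb{R}$ with $f(F)\in F$ for every two-element set $F\subseteq\mathbb{R}$. For distinct $x,y$ write $x<_f y$ if $f(\{x,y\})=x$, and $x\leq_f y$ if $x<_f y$ or $x=y$. For $r,s\in\mathbb{R}$, $(r,s]_f=\{x\in\mathbb{R}: r<_f x\leq_f s\}$ (it is not required that $r<_f s$). For $A\subseteq\mathbb{R}$, $\lambda_f(A)=\inf\{\sum_{n\in\mathbb{N}}|s_n-r_n| : A\subseteq\bigcup_{n\in\mathbb{N}}(r_n,s_n]_f\}$ if $A$ can be covered by countably many intervals $(r,s]_f$, and $\lambda_f(A)=+\infty$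 otherwise. $\mathcal{N}_f=\{A\subseteq\mathbb{R}:\lambda_f(A)=0\}$. *)

theory Defs
  imports "HOL-Library.Extended_Nonnegative_Real"
begin

unbundle cardinal_syntax

abbreviation continuum :: "real rel" where
  "continuum \<equiv> |UNIV :: real set|"

definition ideal_on_reals :: "real set set \<Rightarrow> bool" where
  "ideal_on_reals I \<longleftrightarrow>
     I \<noteq> {} \<and>
     (\<forall>A\<in>I. \<forall>B. B \<subseteq> A \<longrightarrow> B \<in> I) \<and>
     (\<forall>A\<in>I. \<forall>B\<in>I. A \<union> B \<in> I)"

definition lt_continuum_ideal :: "real set set \<Rightarrow> bool" where
  "lt_continuum_ideal I \<longleftrightarrow>
     ideal_on_reals I \<and> (\<forall>F. F \<subseteq> I \<and> |F| <o continuum \<longrightarrow> \<Union>F \<in> I)"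

definition proper_ideal :: "real set set \<Rightarrow> bool" where
  "proper_ideal I \<longleftrightarrow> UNIV \<notin> I"

definition cofinal_family :: "real set set \<Rightarrow> real set set \<Rightarrow> bool" where
  "cofinal_family I B \<longleftrightarrow> B \<subseteq> I \<and> (\<forall>A\<in>I. \<exists>C\<in>B. A \<subseteq> C)"

(* cf(I) = k, with cardinals represented by well-orders up to =o: k is attained
   as the size of a cofinal family and is a lower bound for all such sizes. *)
definition has_cofinality :: "real set set \<Rightarrow> 'k rel \<Rightarrow> bool" where
  "has_cofinality I k \<longleftrightarrow>
     (\<exists>B. cofinal_family I B \<and> |B| =o k) \<and>
     (\<forall>B. cofinal_family I B \<longrightarrow> k \<le>o |B| )"

(* A weak selection is a function on two-element sets; the values of f at other
   sets are arbitrary, and none of the notions below depends on them. *)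
definition weak_selection :: "(real set \<Rightarrow> real) \<Rightarrow> bool" where
  "weak_selection f \<longleftrightarrow> (\<forall>F. card F = 2 \<longrightarrow> f F \<in> F)"

definition sel_less :: "(real set \<Rightarrow> real) \<Rightarrow> real \<Rightarrow> real \<Rightarrow> bool" where
  "sel_less f x y \<longleftrightarrow> x \<noteq> y \<and> f {x, y} = x"

definition sel_le :: "(real set \<Rightarrow> real) \<Rightarrow> real \<Rightarrow> real \<Rightarrow> bool" where
  "sel_le f x y \<longleftrightarrow> sel_less f x y \<or> x = y"

definition sel_interval :: "(real set \<Rightarrow> real) \<Rightarrow> real \<Rightarrow> real \<Rightarrow> real set" where
  "sel_interval f r s = {x. sel_less f r x \<and> sel_le f x s}"

definition sel_cover ::
  "(real set \<Rightarrow> real) \<Rightarrow> real set \<Rightarrow> (nat \<Rightarrow> real) \<Rightarrow> (nat \<Rightarrow> real) \<Rightarrow> bool" where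
  "sel_cover f A r s \<longleftrightarrow> A \<subseteq> (\<Union>n. sel_interval f (r n) (s n))"

(* Covers by finitely many intervals need no separate treatment, since
   sel_interval f r r is empty. *)
definition sel_outer :: "(real set \<Rightarrow> real) \<Rightarrow> real set \<Rightarrow> ennreal" where
  "sel_outer f A =
     (if \<exists>r s. sel_cover f A r s
      then Inf {(\<Sum>n. ennreal \<bar>s n - r n\<bar>) | r s. sel_cover f A r s}
      else \<infinity>)"

definition sel_null :: "(real set \<Rightarrow> real) \<Rightarrow> real set set" where
  "sel_null f = {A. sel_outer f A = 0}"

end

theory Submission
  imports Defs "HOL-Analysis.Continuum_Not_Denumerable"
begin

text \<open>
  It suffices to find \<open>f\<close> such that every interval \<open>(r, s]\<^sub>f\<close> lies in \<open>I\<close>, while every member of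
  \<open>I\<close> is contained in a single interval \<open>(r, s]\<^sub>f\<close> with \<open>\<bar>s - r\<bar>\<close> as small as desired: countable
  unions of members of \<open>I\<close> stay in \<open>I\<close> because the continuum is uncountable
  (\<open>sel_null_eqI\<close>).

  The cofinality hypothesis lists a cofinal subfamily of \<open>I\<close> as \<open>B \<alpha>\<close>, with the indices \<open>\<alpha>\<close>
  ranging over the reals themselves, each paired with a tolerance \<open>\<delta> \<alpha>\<close>, so that every set of the
  subfamily occurs with arbitrarily small tolerances. Well-order the reals in type continuum; all
  initial segments then have fewer than continuum many points and belong to \<open>I\<close>. Recursion along
  this order yields points \<open>r \<alpha>\<close> and \<open>s \<alpha>\<close> at distance less than \<open>\<delta> \<alpha>\<close>, outside \<open>B \<beta>\<close> for all
  \<open>\<beta> \<le> \<alpha>\<close> and later in the well-order than all points chosen before. This is possible because the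
  sets to be avoided have union in \<open>I\<close>, and the complement of a member of a proper ideal is
  uncountable, hence contains distinct points at arbitrarily small distance
  (\<open>endpoints_exist\<close>).

  Call the points \<open>s \<alpha>\<close> high and all other reals low. By default, a high point lies above and a low
  point lies below everything that precedes it in the well-order; so the set of points above
  \<open>x\<close> is, up to an initial segment, the same for every \<open>x\<close>. The only exceptions are that a later
  \<open>z \<in> B \<alpha>\<close> is always placed above \<open>r \<alpha>\<close> and below \<open>s \<alpha>\<close>. This puts the later points of \<open>B \<alpha>\<close>
  into \<open>(r \<alpha>, s \<alpha>]\<^sub>f\<close>, and the earlier ones belong to it because \<open>r \<alpha>\<close> is low and \<open>s \<alpha>\<close> is high, the
  avoidance conditions ensuring that no exception affects this. Conversely, as each point is subject
  to exceptions from at most one \<open>B \<alpha>\<close>, every interval is covered by two initial segments and two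
  of the sets \<open>B \<alpha>\<close> (\<open>selection_with_prescribed_intervals\<close>).
\<close>

section \<open>Weak selections and tournaments\<close>

lemma tournament_weak_selection:
  fixes T :: "real \<Rightarrow> real \<Rightarrow> bool"
  assumes tour: "\<And>x y. x \<noteq> y \<Longrightarrow> T x y \<longleftrightarrow> \<not> T y x"
  shows "\<exists>f. weak_selection f \<and> (\<forall>x y. sel_less f x y \<longleftrightarrow> x \<noteq> y \<and> T x y)"
proof -
  define f where "f F = (SOME x. x \<in> F \<and> (\<forall>y\<in>F. y \<noteq> x \<longrightarrow> T x y))" for F
  have f_pair: "f {x, y} = x" if "x \<noteq> y" "T x y" for x y
    unfolding f_def using that tour[of x y] by (intro some_equality) auto
  have f_pair': "f {x, y} = y" if "x \<noteq> y" "\<not> T x y" for x y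
    using f_pair[of y x] that tour[of x y] by (simp add: insert_commute)
  have "weak_selection f"
    unfolding weak_selection_def
  proof (intro allI impI)
    fix F :: "real set" assume "card F = 2"
    then obtain x y where "F = {x, y}" "x \<noteq> y" by (auto simp: card_2_iff)
    then show "f F \<in> F" using f_pair f_pair' by (cases "T x y") auto
  qed
  moreover have "sel_less f x y \<longleftrightarrow> x \<noteq> y \<and> T x y" for x y
    unfolding sel_less_def using f_pair f_pair' by metis
  ultimately show ?thesis by blast
qed

section \<open>Ideals closed under unions of size less than the continuum\<close>

lemma countable_ordLess_continuum:
  assumes "countable A" shows "|A| <o continuum"
proof -
  have "\<not> continuum \<le>o |A|"
  proof
    assume "continuum \<le>o |A|"
    then obtain h where "inj_on h (UNIV :: real set)" "range h \<subseteq> A"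
      using card_of_ordLeq[of "UNIV :: real set" A] by blast
    then have "countable (UNIV :: real set)"
      using assms countable_image_inj_on countable_subset by metis
    then show False using uncountable_UNIV_real by blast
  qed
  then show ?thesis by (simp add: card_of_Well_order not_ordLeq_iff_ordLess)
qed

lemma lt_continuum_ideal_mono:
  assumes "lt_continuum_ideal I" "A \<in> I" "B \<subseteq> A" shows "B \<in> I"
  using assms unfolding lt_continuum_ideal_def ideal_on_reals_def by blast

lemma lt_continuum_ideal_Un:
  assumes "lt_continuum_ideal I" "A \<in> I" "B \<in> I" shows "A \<union> B \<in> I"
  using assms unfolding lt_continuum_ideal_def ideal_on_reals_def by blast

lemma lt_continuum_ideal_UN:
  assumes "lt_continuum_ideal I" "|K| <o continuum" "\<And>k. k \<in> K \<Longrightarrow> X k \<in> I"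
  shows "(\<Union>k\<in>K. X k) \<in> I"
proof -
  have "|X ` K| <o continuum"
    using card_of_image assms(2) by (rule ordLeq_ordLess_trans)
  then show ?thesis using assms unfolding lt_continuum_ideal_def by blast
qed

text \<open>
  A set without two distinct points at distance less than \<open>\<epsilon>\<close> meets each of the half-open intervals
  of length \<open>\<epsilon>\<close> with endpoints in \<open>\<epsilon>\<int>\<close> in at most one point and is therefore countable.
  The complement of a member of a proper ideal is not.
\<close>

lemma close_pair_outside_ideal_set:
  assumes ideal: "lt_continuum_ideal I" and proper: "proper_ideal I"
    and small: "{A. |A| <o continuum} \<subseteq> I"
    and "X \<in> I" and "\<epsilon> > 0"
  shows "\<exists>r s. r \<notin> X \<and> s \<notin> X \<and> r \<noteq> s \<and> \<bar>s - r\<bar> < \<epsilon>"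
proof -
  define h where "h x = \<lfloor>x / \<epsilon>\<rfloor>" for x :: real
  have "\<not> countable (- X)"
  proof
    assume "countable (- X)"
    then have "- X \<in> I" using small countable_ordLess_continuum by blast
    then have "X \<union> - X \<in> I" using ideal \<open>X \<in> I\<close> by (intro lt_continuum_ideal_Un)
    then show False using proper by (simp add: proper_ideal_def)
  qed
  then have "\<not> inj_on h (- X)" by (meson countableI_type countable_image_inj_on)
  then obtain r s where rs: "r \<notin> X" "s \<notin> X" "r \<noteq> s" "h r = h s"
    by (auto simp: inj_on_def)
  have "\<bar>s / \<epsilon> - r / \<epsilon>\<bar> < 1" using \<open>h r = h s\<close> unfolding h_def by linarith
  then have "\<bar>s - r\<bar> < \<epsilon>" using \<open>\<epsilon> > 0\<close>
    by (simp add: diff_divide_distrib[symmetric] abs_divide)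
  then show ?thesis using rs by blast
qed

section \<open>Recognising the null ideal\<close>

text \<open>
  Being null enters the first inclusion only through the existence of some countable cover by
  intervals. Hence, under these hypotheses, every set outside \<open>I\<close> has infinite outer measure.
\<close>

lemma sel_null_eqI:
  assumes ideal: "lt_continuum_ideal I"
    and interval_in: "\<And>r s. sel_interval f r s \<in> I"
    and cover: "\<And>A \<epsilon>. A \<in> I \<Longrightarrow> \<epsilon> > 0 \<Longrightarrow> \<exists>r s. A \<subseteq> sel_interval f r s \<and> \<bar>s - r\<bar> < \<epsilon>"
  shows "sel_null f = I"
proof (intro set_eqI iffI)
  fix A assume "A \<in> sel_null f"
  then have "sel_outer f A \<noteq> \<infinity>" by (simp add: sel_null_def)
  then obtain r s where "sel_cover f A r s"
    by (auto simp: sel_outer_def split: if_splits)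
  then have sub: "A \<subseteq> (\<Union>n. sel_interval f (r n) (s n))" by (simp add: sel_cover_def)
  have "(\<Union>n. sel_interval f (r n) (s n)) \<in> I"
    using ideal interval_in by (intro lt_continuum_ideal_UN countable_ordLess_continuum) auto
  then show "A \<in> I" using ideal sub by (intro lt_continuum_ideal_mono[of I _ A])
next
  fix A assume "A \<in> I"
  have ex: "\<exists>r s. sel_cover f A r s \<and> (\<Sum>n. ennreal \<bar>s n - r n\<bar>) \<le> ennreal \<epsilon>"
    if \<epsilon>_pos: "\<epsilon> > 0" for \<epsilon>
  proof -
    obtain a b where ab: "A \<subseteq> sel_interval f a b" "\<bar>b - a\<bar> < \<epsilon>"
      using cover[OF \<open>A \<in> I\<close> \<epsilon>_pos] by blast
    \<comment> \<open>The single interval is padded with the empty intervals from \<open>a\<close> to \<open>a\<close>.\<close>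
    define s where "s n = (if n = 0 then b else a)" for n :: nat
    have "sel_cover f A (\<lambda>_. a) s"
      using ab(1) UN_upper[of "0 :: nat" UNIV "\<lambda>n. sel_interval f a (s n)"]
      by (simp add: sel_cover_def s_def subset_trans)
    moreover have "(\<Sum>n. ennreal \<bar>s n - a\<bar>) = (\<Sum>n\<in>{0}. ennreal \<bar>s n - a\<bar>)"
      by (rule suminf_finite) (auto simp: s_def)
    moreover have "(\<Sum>n\<in>{0}. ennreal \<bar>s n - a\<bar>) \<le> ennreal \<epsilon>"
      using ab(2) by (simp add: s_def ennreal_leI)
    ultimately show ?thesis by (intro exI[of _ "\<lambda>_. a"] exI[of _ s]) simp
  qed
  have "sel_outer f A \<le> 0 + ennreal \<epsilon>" if \<epsilon>_pos: "\<epsilon> > 0" for \<epsilon>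
  proof -
    obtain r s where rs: "sel_cover f A r s" "(\<Sum>n. ennreal \<bar>s n - r n\<bar>) \<le> ennreal \<epsilon>"
      using ex[OF \<epsilon>_pos] by blast
    then have "sel_outer f A \<le> (\<Sum>n. ennreal \<bar>s n - r n\<bar>)"
      unfolding sel_outer_def by (auto intro!: Inf_lower)
    then show ?thesis using rs(2) by simp
  qed
  then have "sel_outer f A \<le> 0" by (rule ennreal_le_epsilon) auto
  then show "A \<in> sel_null f" by (simp add: sel_null_def)
qed

section \<open>Listing a cofinal family with tolerances\<close>

text \<open>
  The product of the cofinal family with the natural numbers is still no larger than the continuum,
  so a surjection from the reals onto it lists each of its sets together with every tolerance
  \<open>1 / (n + 1)\<close>.
\<close>

lemma cofinal_family_enumeration:
  assumes "cofinal_family I \<B>" "|\<B>| \<le>o continuum" "I \<noteq> {}"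
  shows "\<exists>(B :: real \<Rightarrow> real set) \<delta> :: real \<Rightarrow> real. (\<forall>\<alpha>. B \<alpha> \<in> I \<and> \<delta> \<alpha> > 0) \<and>
    (\<forall>A\<in>I. \<forall>\<epsilon>>0. \<exists>\<alpha>. A \<subseteq> B \<alpha> \<and> \<delta> \<alpha> < \<epsilon>)"
proof -
  have "\<B> \<noteq> {}" using assms(1,3) by (auto simp: cofinal_family_def)
  have "|UNIV :: nat set| \<le>o continuum"
    by (rule ordLess_imp_ordLeq, rule countable_ordLess_continuum) simp
  then have "|\<B> \<times> (UNIV :: nat set)| \<le>o continuum"
    using assms(2) infinite_UNIV_char_0 by (intro card_of_Sigma_ordLeq_infinite ballI)
  then obtain g where g: "g ` (UNIV :: real set) = \<B> \<times> (UNIV :: nat set)"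
    using card_of_ordLeq2[of "\<B> \<times> (UNIV :: nat set)" "UNIV :: real set"] \<open>\<B> \<noteq> {}\<close> by auto
  have "fst (g \<alpha>) \<in> I" for \<alpha>
    using g assms(1) by (metis SigmaE cofinal_family_def fst_conv rangeI subsetD)
  moreover have "\<exists>\<alpha>. A \<subseteq> fst (g \<alpha>) \<and> inverse (real (Suc (snd (g \<alpha>)))) < \<epsilon>"
    if "A \<in> I" "\<epsilon> > 0" for A \<epsilon>
  proof -
    obtain C where C: "C \<in> \<B>" "A \<subseteq> C"
      using assms(1) \<open>A \<in> I\<close> by (auto simp: cofinal_family_def)
    obtain n where n: "inverse (real (Suc n)) < \<epsilon>" using reals_Archimedean[OF \<open>\<epsilon> > 0\<close>] by auto
    obtain \<alpha> where "g \<alpha> = (C, n)" using C g by (metis SigmaI UNIV_I imageE)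
    then show ?thesis using C n by (intro exI[of _ \<alpha>]) auto
  qed
  ultimately show ?thesis
    by (intro exI[of _ "\<lambda>\<alpha>. fst (g \<alpha>)"] exI[of _ "\<lambda>\<alpha>. inverse (real (Suc (snd (g \<alpha>))))"]) auto
qed

section \<open>Choosing the endpoints\<close>

lemma initial_segment_in_ideal:
  assumes ideal: "lt_continuum_ideal I" and small: "{A. |A| <o continuum} \<subseteq> I"
  shows "under continuum x \<in> I"
proof -
  have "|underS continuum x| <o continuum"
    by (rule card_of_underS[OF card_of_Card_order]) (simp add: Field_card_of)
  moreover have "|{x}| <o continuum" by (rule countable_ordLess_continuum) simp
  ultimately have "underS continuum x \<union> {x} \<in> I"
    using ideal small by (intro lt_continuum_ideal_Un) auto
  then show ?thesis
    by (rule lt_continuum_ideal_mono[OF ideal]) (auto simp: under_def underS_def)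
qed

text \<open>
  Staying outside the initial segments up to the points chosen before makes the order of the points
  agree with the order of their indices. The later comparison of two chosen points can then be
  traced back to the indices, for which avoidance of \<open>B \<beta>\<close> is arranged.
\<close>

lemma endpoints_exist:
  fixes B :: "real \<Rightarrow> real set" and \<delta> :: "real \<Rightarrow> real"
  assumes ideal: "lt_continuum_ideal I" and proper: "proper_ideal I"
    and small: "{A. |A| <o continuum} \<subseteq> I"
    and B_in: "\<And>\<alpha>. B \<alpha> \<in> I" and \<delta>_pos: "\<And>\<alpha>. \<delta> \<alpha> > 0"
  shows "\<exists>r s. \<forall>\<alpha>. r \<alpha> \<noteq> s \<alpha> \<and> \<bar>s \<alpha> - r \<alpha>\<bar> < \<delta> \<alpha> \<and>
    r \<alpha> \<notin> B \<alpha> \<and> s \<alpha> \<notin> B \<alpha> \<and>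
    (\<forall>\<beta> \<in> underS continuum \<alpha>. {r \<alpha>, s \<alpha>} \<inter> (B \<beta> \<union> under continuum (r \<beta>) \<union> under continuum (s \<beta>)) = {})"
proof -
  define X where "X p \<alpha> = B \<alpha> \<union> (\<Union>\<beta> \<in> underS continuum \<alpha>.
    B \<beta> \<union> under continuum (fst (p \<beta>)) \<union> under continuum (snd (p \<beta>)))"
    for p :: "real \<Rightarrow> real \<times> real" and \<alpha>
  define P where "P p \<alpha> q \<longleftrightarrow>
    fst q \<notin> X p \<alpha> \<and> snd q \<notin> X p \<alpha> \<and> fst q \<noteq> snd q \<and> \<bar>snd q - fst q\<bar> < \<delta> \<alpha>"
    for p :: "real \<Rightarrow> real \<times> real" and \<alpha> q
  have "\<exists>p. \<forall>\<alpha>. P p \<alpha> (p \<alpha>)"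
  proof (rule dependent_wf_choice[where P = P])
    show "wf (continuum - Id)"
      using card_of_Well_order[of "UNIV :: real set"] by (simp add: well_order_on_def)
  next
    fix p p' :: "real \<Rightarrow> real \<times> real" and \<alpha> q
    assume "\<And>\<beta>. (\<beta>, \<alpha>) \<in> continuum - Id \<Longrightarrow> p \<beta> = p' \<beta>"
    then have "X p \<alpha> = X p' \<alpha>" unfolding X_def by (auto simp: underS_def)
    then show "P p \<alpha> q = P p' \<alpha> q" by (simp add: P_def)
  next
    fix \<alpha> and p :: "real \<Rightarrow> real \<times> real"
    have "|underS continuum \<alpha>| <o continuum"
      by (rule card_of_underS[OF card_of_Card_order]) (simp add: Field_card_of)
    then have "X p \<alpha> \<in> I" unfolding X_def
      by (intro lt_continuum_ideal_Un[OF ideal] lt_continuum_ideal_UN[OF ideal] B_in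
          initial_segment_in_ideal[OF ideal small])
    from close_pair_outside_ideal_set[OF ideal proper small this \<delta>_pos[of \<alpha>]]
    show "\<exists>q. P p \<alpha> q" by (auto simp: P_def)
  qed
  then obtain p where p: "\<And>\<alpha>. P p \<alpha> (p \<alpha>)" by blast
  show ?thesis
  proof (rule exI[of _ "fst \<circ> p"], rule exI[of _ "snd \<circ> p"], intro allI)
    fix \<alpha>
    have "{fst (p \<alpha>), snd (p \<alpha>)} \<inter> X p \<alpha> = {}" using p[of \<alpha>] by (simp add: P_def)
    then show "(fst \<circ> p) \<alpha> \<noteq> (snd \<circ> p) \<alpha> \<and>
      \<bar>(snd \<circ> p) \<alpha> - (fst \<circ> p) \<alpha>\<bar> < \<delta> \<alpha> \<and>
      (fst \<circ> p) \<alpha> \<notin> B \<alpha> \<and> (snd \<circ> p) \<alpha> \<notin> B \<alpha> \<and>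
      (\<forall>\<beta> \<in> underS continuum \<alpha>. {(fst \<circ> p) \<alpha>, (snd \<circ> p) \<alpha>} \<inter>
        (B \<beta> \<union> under continuum ((fst \<circ> p) \<beta>) \<union> under continuum ((snd \<circ> p) \<beta>)) = {})"
      using p[of \<alpha>] unfolding P_def X_def o_def by blast
  qed
qed

section \<open>A selection with prescribed intervals\<close>

text \<open>
  The tournament is specified by saying, for \<open>x\<close> before \<open>z\<close> in the well-order, whether \<open>z\<close> is put
  above \<open>x\<close>. That decision depends on \<open>x\<close> only for \<open>z\<close> in the one set \<open>B \<alpha>\<close> attached to \<open>x\<close>. Two
  points therefore have the same later points above them up to two sets \<open>B \<alpha>\<close>, \<open>B \<beta>\<close>, which
  bounds every interval.
\<close>

lemma selection_with_prescribed_intervals: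
  fixes B :: "real \<Rightarrow> real set" and r s :: "real \<Rightarrow> real"
  assumes distinct: "\<And>\<alpha>. r \<alpha> \<noteq> s \<alpha>"
    and outside: "\<And>\<alpha>. r \<alpha> \<notin> B \<alpha>" "\<And>\<alpha>. s \<alpha> \<notin> B \<alpha>"
    and later: "\<And>\<alpha> \<beta>. \<beta> \<in> underS continuum \<alpha> \<Longrightarrow>
      {r \<alpha>, s \<alpha>} \<inter> (B \<beta> \<union> under continuum (r \<beta>) \<union> under continuum (s \<beta>)) = {}"
  shows "\<exists>f. weak_selection f \<and>
    (\<forall>\<alpha>. B \<alpha> \<subseteq> sel_interval f (r \<alpha>) (s \<alpha>)) \<and>
    (\<forall>x y. \<exists>\<alpha> \<beta>. sel_interval f x y \<subseteq> under continuum x \<union> under continuum y \<union> B \<alpha> \<union> B \<beta>)"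
proof -
  define W where "W x y \<longleftrightarrow> (x, y) \<in> continuum" for x y :: real
  have lin: "linear_order continuum"
    using card_of_well_order_on[of "UNIV :: real set"] by (simp add: well_order_on_def Field_card_of)
  have W_refl: "W x x" for x
    using lin unfolding W_def linear_order_on_def partial_order_on_def preorder_on_def refl_on_def
    by (simp add: Field_card_of)
  have W_antisym: "x = y" if "W x y" "W y x" for x y
    using lin that unfolding W_def linear_order_on_def partial_order_on_def antisym_def by simp
  have W_total: "W x y \<or> W y x" for x y
    using lin W_refl unfolding W_def linear_order_on_def total_on_def
    by (cases "x = y") (auto simp: Field_card_of)

  have later': "u \<notin> B \<beta> \<and> \<not> W u (r \<beta>) \<and> \<not> W u (s \<beta>)"
    if "W \<beta> \<alpha>" "\<beta> \<noteq> \<alpha>" "u \<in> {r \<alpha>, s \<alpha>}" for \<alpha> \<beta> u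
    using later[of \<beta> \<alpha>] that by (auto simp: underS_def under_def W_def)
  \<comment> \<open>Each chosen point has a unique index, so at most one set \<open>B \<alpha>\<close> is attached to it.\<close>
  have index_inj: "\<alpha> = \<beta>" if "u \<in> {r \<alpha>, s \<alpha>}" "u \<in> {r \<beta>, s \<beta>}" for \<alpha> \<beta> u
  proof (rule ccontr)
    assume "\<alpha> \<noteq> \<beta>"
    then show False
      using later'[of \<alpha> \<beta> u] later'[of \<beta> \<alpha> u] W_total[of \<alpha> \<beta>] W_refl[of u] that by auto
  qed
  have r_ne_s: "r \<alpha> \<noteq> s \<beta>" for \<alpha> \<beta>
    using index_inj[of "r \<alpha>" \<alpha> \<beta>] distinct by auto
  \<comment> \<open>A chosen point \<open>u\<close> is never an exception for an earlier chosen point \<open>v\<close>, since the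
    index of \<open>v\<close> is at most that of \<open>u\<close>.\<close>
  have avoid: "u \<notin> B \<beta>" if "u \<in> {r \<alpha>, s \<alpha>}" "v \<in> {r \<beta>, s \<beta>}" "W v u" for \<alpha> \<beta> u v
  proof (cases "W \<beta> \<alpha>")
    case True
    then show ?thesis using later'[of \<beta> \<alpha> u] outside that by (cases "\<beta> = \<alpha>") auto
  next
    case False
    then have "W \<alpha> \<beta>" "\<alpha> \<noteq> \<beta>" using W_total W_refl by auto
    then show ?thesis using later'[of \<alpha> \<beta> v] that by auto
  qed

  \<comment> \<open>\<open>up x y\<close> decides that \<open>y\<close> goes above \<open>x\<close>; it is meant for \<open>x\<close> before \<open>y\<close> in the
    well-order.\<close>
  define up where "up x y \<longleftrightarrow> (\<exists>\<alpha>. x = r \<alpha> \<and> y \<in> B \<alpha>) \<or>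
    (y \<in> range s \<and> \<not> (\<exists>\<alpha>. x = s \<alpha> \<and> y \<in> B \<alpha>))" for x y
  define T where "T x y \<longleftrightarrow> (if W x y then up x y else \<not> up y x)" for x y
  have tour: "T x y \<longleftrightarrow> \<not> T y x" if "x \<noteq> y" for x y
    using that W_total[of x y] W_antisym[of x y] by (auto simp: T_def)
  from tournament_weak_selection[of T, OF tour] obtain f where f: "weak_selection f"
    and less: "\<And>x y. sel_less f x y \<longleftrightarrow> x \<noteq> y \<and> T x y" by auto
  have "B \<alpha> \<subseteq> sel_interval f (r \<alpha>) (s \<alpha>)" for \<alpha>
  proof
    fix x assume x: "x \<in> B \<alpha>"
    have ne: "x \<noteq> r \<alpha>" "x \<noteq> s \<alpha>" using x outside by auto
    have "T (r \<alpha>) x"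
    proof (cases "W (r \<alpha>) x")
      case True
      then show ?thesis using x by (auto simp: T_def up_def)
    next
      case False
      then have "W x (r \<alpha>)" using W_total by blast
      then have "\<not> up x (r \<alpha>)" using avoid[of "r \<alpha>" \<alpha> x] r_ne_s by (auto simp: up_def)
      then show ?thesis using False by (simp add: T_def)
    qed
    moreover have "T x (s \<alpha>)"
    proof (cases "W x (s \<alpha>)")
      case True
      then have "up x (s \<alpha>)" using avoid[of "s \<alpha>" \<alpha> x] by (auto simp: up_def)
      then show ?thesis using True by (simp add: T_def)
    next
      case False
      have "\<not> up (s \<alpha>) x" using x r_ne_s[symmetric] by (auto simp: up_def)
      then show ?thesis using False by (simp add: T_def)
    qed
    ultimately show "x \<in> sel_interval f (r \<alpha>) (s \<alpha>)"
      using ne by (auto simp: sel_interval_def sel_le_def less)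
  qed
  moreover have "\<exists>\<alpha> \<beta>. sel_interval f x y \<subseteq>
    under continuum x \<union> under continuum y \<union> B \<alpha> \<union> B \<beta>" for x y
  proof -
    \<comment> \<open>For \<open>x\<close> not among the chosen points any \<open>\<alpha>\<close> will do.\<close>
    have up_iff: "\<exists>\<alpha>. \<forall>z. z \<notin> B \<alpha> \<longrightarrow> (up x z \<longleftrightarrow> z \<in> range s)" for x
    proof (cases "\<exists>\<alpha>. x \<in> {r \<alpha>, s \<alpha>}")
      case True
      then obtain \<alpha> where \<alpha>: "x \<in> {r \<alpha>, s \<alpha>}" by blast
      then have "\<beta> = \<alpha>" if "x = r \<beta> \<or> x = s \<beta>" for \<beta>
        using index_inj[of x \<beta> \<alpha>] that by blast
      then show ?thesis unfolding up_def by blast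
    next
      case False
      then show ?thesis by (auto simp: up_def)
    qed
    obtain \<alpha> where \<alpha>: "\<And>z. z \<notin> B \<alpha> \<Longrightarrow> up x z \<longleftrightarrow> z \<in> range s" using up_iff by blast
    obtain \<beta> where \<beta>: "\<And>z. z \<notin> B \<beta> \<Longrightarrow> up y z \<longleftrightarrow> z \<in> range s" using up_iff by blast
    have "z \<in> under continuum x \<union> under continuum y \<union> B \<alpha> \<union> B \<beta>"
      if z: "z \<in> sel_interval f x y" for z
    proof (rule ccontr)
      assume "\<not> ?thesis"
      then have nz: "\<not> W z x" "\<not> W z y" "z \<notin> B \<alpha>" "z \<notin> B \<beta>"
        by (auto simp: under_def W_def)
      have "T x z" "z = y \<or> T z y"
        using z by (auto simp: sel_interval_def sel_le_def less)
      then have "up x z" "\<not> up y z"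
        using nz W_total[of x z] W_refl[of z] by (auto simp: T_def)
      then show False using \<alpha> \<beta> nz by blast
    qed
    then show ?thesis by blast
  qed
  ultimately show ?thesis using f by blast
qed

section \<open>Realising the ideal\<close>

theorem theorem3p1:
  fixes I :: "real set set"
  assumes "lt_continuum_ideal I"
    and "proper_ideal I"
    and "{A :: real set. |A| <o continuum} \<subseteq> I"
    and "has_cofinality I continuum"
  shows "\<exists>f :: real set \<Rightarrow> real. weak_selection f \<and> sel_null f = I"
proof -
  note ideal = assms(1)
  obtain \<B> where "cofinal_family I \<B>" "|\<B>| =o continuum"
    using assms(4) unfolding has_cofinality_def by blast
  moreover have "I \<noteq> {}" using ideal by (simp add: lt_continuum_ideal_def ideal_on_reals_def)
  ultimately obtain B \<delta> where B: "\<And>\<alpha>. B \<alpha> \<in> I" and \<delta>: "\<And>\<alpha>. (\<delta> \<alpha> :: real) > 0"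
    and cof: "\<And>A \<epsilon>. A \<in> I \<Longrightarrow> \<epsilon> > 0 \<Longrightarrow> \<exists>\<alpha> :: real. A \<subseteq> B \<alpha> \<and> \<delta> \<alpha> < \<epsilon>"
    using cofinal_family_enumeration[of I \<B>] ordIso_imp_ordLeq by metis
  obtain r s where rs: "\<And>\<alpha>. r \<alpha> \<noteq> s \<alpha> \<and> \<bar>s \<alpha> - r \<alpha>\<bar> < \<delta> \<alpha> \<and> r \<alpha> \<notin> B \<alpha> \<and> s \<alpha> \<notin> B \<alpha> \<and>
    (\<forall>\<beta> \<in> underS continuum \<alpha>. {r \<alpha>, s \<alpha>} \<inter> (B \<beta> \<union> under continuum (r \<beta>) \<union> under continuum (s \<beta>)) = {})"
    using endpoints_exist[of I B \<delta>, OF ideal assms(2,3) B \<delta>] by auto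
  have "\<exists>f. weak_selection f \<and> (\<forall>\<alpha>. B \<alpha> \<subseteq> sel_interval f (r \<alpha>) (s \<alpha>)) \<and>
    (\<forall>x y. \<exists>\<alpha> \<beta>. sel_interval f x y \<subseteq> under continuum x \<union> under continuum y \<union> B \<alpha> \<union> B \<beta>)"
    by (rule selection_with_prescribed_intervals) (use rs in blast)+
  then obtain f where f: "weak_selection f" "\<And>\<alpha>. B \<alpha> \<subseteq> sel_interval f (r \<alpha>) (s \<alpha>)"
    and interval: "\<And>x y. \<exists>\<alpha> \<beta>. sel_interval f x y \<subseteq>
      under continuum x \<union> under continuum y \<union> B \<alpha> \<union> B \<beta>" by blast
  have "sel_null f = I"
  proof (rule sel_null_eqI[OF ideal])
    fix x y
    obtain \<alpha> \<beta> where sub: "sel_interval f x y \<subseteq>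
      under continuum x \<union> under continuum y \<union> B \<alpha> \<union> B \<beta>" using interval by blast
    have "under continuum x \<union> under continuum y \<union> B \<alpha> \<union> B \<beta> \<in> I"
      by (intro lt_continuum_ideal_Un[OF ideal] B initial_segment_in_ideal[OF ideal assms(3)])
    then show "sel_interval f x y \<in> I" using sub by (rule lt_continuum_ideal_mono[OF ideal])
  next
    fix A and \<epsilon> :: real assume "A \<in> I" "\<epsilon> > 0"
    then obtain \<alpha> where "A \<subseteq> B \<alpha>" "\<delta> \<alpha> < \<epsilon>" using cof by blast
    then show "\<exists>r s. A \<subseteq> sel_interval f r s \<and> \<bar>s - r\<bar> < \<epsilon>"
      using f(2)[of \<alpha>] rs[of \<alpha>] by (intro exI[of _ "r \<alpha>"] exI[of _ "s \<alpha>"]) auto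
  qed
  then show ?thesis using f(1) by blast
qed

end
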